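(* If $T$ is a tree, then $b^A_g(T)\ge 0$ and $b^I_g(T)\ge 0$.
   Context: The balance game on a finite simple graph $G$ is played by two players, Admirable (A) and Impish (I), who alternately select a not-yet-labeled vertex of $G$ until all vertices are labeled; Admirable labels each vertex she selects by $0$ and Impish labels each vertex he selects by $1$. Each edge receives the sum modulo $2$ of the labels of its endpoints. Let $e_0$ and $e_1$ be the numbers of edges labeled $0$ and $1$ at the end; the discrepancy is $d=e_1-e_0$. Admirable tries to minimize $d$ and Impish tries to maximize $d$. $b^A_g(G)$ is the value of $d$ under optimal play of both players when Admirable moves first, and $b^I_g(G)$ is the value under optimal play when Impish moves first. *)

theory Defs
  imports "Graph_Theory.Graph_Theory"
begin

text \<open>
  A finite simple graph is a digraph satisfying the locale predicate \<open>graph\<close> (finite, symmetric, no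
  loops, no parallel arcs), so every undirected edge is represented by two opposite arcs.
  Undirected edges are recovered as two-element sets of end points.
\<close>

definition edges :: "('a, 'b) pre_digraph \<Rightarrow> 'a set set" where
  "edges G = {{u, v} | u v. u \<rightarrow>\<^bsub>G\<^esub> v}"

text \<open>
  The constant \<open>tree\<close> of the imported library does not suit symmetric digraphs: there, the
  two arcs of a single edge already form a cycle. Undirected cycles are the cycles of length at
  least 3. Note that \<open>connected\<close> includes that there is at least one vertex.
\<close>

definition undirected_tree :: "('a, 'b) pre_digraph \<Rightarrow> bool" where
  "undirected_tree G \<longleftrightarrow>
     graph G \<and> Digraph_Component.connected G \<and> \<not> (\<exists>p. pre_digraph.cycle G p \<and> 3 \<le> length p)"

definition edge_label :: "('a \<Rightarrow> nat) \<Rightarrow> 'a set \<Rightarrow> nat" where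
  "edge_label f e = (\<Sum>v\<in>e. f v) mod 2"

definition discrepancy :: "('a, 'b) pre_digraph \<Rightarrow> ('a \<Rightarrow> nat) \<Rightarrow> int" where
  "discrepancy G f =
     int (card {e \<in> edges G. edge_label f e = 1}) - int (card {e \<in> edges G. edge_label f e = 0})"

datatype player = Admirable | Impish

text \<open>
  A position consists of the player to move and the partial labeling \<open>L\<close> built so far. Its value
  under optimal play is given by backward induction; \<open>finite (verts G)\<close> is only there to guarantee
  termination.
\<close>

definition unlabeled :: "('a, 'b) pre_digraph \<Rightarrow> ('a \<rightharpoonup> nat) \<Rightarrow> 'a set" where
  "unlabeled G L = verts G - dom L"

function game_value :: "('a, 'b) pre_digraph \<Rightarrow> player \<Rightarrow> ('a \<rightharpoonup> nat) \<Rightarrow> int" where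
  "game_value G P L =
     (if finite (verts G) \<and> unlabeled G L \<noteq> {} then
        (case P of
           Admirable \<Rightarrow> Min ((\<lambda>v. game_value G Impish (L(v \<mapsto> 0))) ` unlabeled G L)
         | Impish \<Rightarrow> Max ((\<lambda>v. game_value G Admirable (L(v \<mapsto> 1))) ` unlabeled G L))
      else discrepancy G (\<lambda>v. the (L v)))"
  by pat_completeness auto
termination
proof (relation "measure (\<lambda>(G, P, L). card (unlabeled G L))", goal_cases)
  case 1
  then show ?case by simp
qed (auto simp: unlabeled_def simp del: card_Diff_insert intro!: psubset_card_mono)

text \<open>The defining equation of \<open>game_value\<close> would loop as a rewrite rule.\<close>

declare game_value.simps [simp del]

definition balance_game_A :: "('a, 'b) pre_digraph \<Rightarrow> int" where
  "balance_game_A G = game_value G Admirable Map.empty"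

definition balance_game_I :: "('a, 'b) pre_digraph \<Rightarrow> int" where
  "balance_game_I G = game_value G Impish Map.empty"

end

theory Submission
  imports Defs "HOL-Library.Disjoint_Sets"
begin

text \<open>
  Write Impish's labels as \<open>+1\<close> and Admirable's as \<open>-1\<close>, so that the discrepancy is minus the sum of
  the products of the signs over the edges.

  If Admirable makes the last move, Impish always takes an unlabeled vertex with the smallest sum of
  signs over its labeled neighbours. Each pair of moves (Impish, Admirable) then does not decrease
  the discrepancy, on any graph.

  If Impish makes the last move, he plays a pairing strategy. Root the tree and work upwards: the
  children that are left unpaired within their own subtrees are paired with each other as far as
  possible, and a last one is paired with its parent. A pair of siblings contributes \<open>0\<close> through the
  edges to the common parent. A vertex paired with a child gains \<open>1\<close> on that edge, which pays for its
  own edge to its parent. In a tree of odd order the root is left over, and Impish starts with it.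
\<close>

section \<open>Signed cuts and the effect of labeling one vertex\<close>

definition signed_cut :: "'a set set \<Rightarrow> ('a \<Rightarrow> int) \<Rightarrow> int" where
  "signed_cut E x = - (\<Sum>e\<in>E. \<Prod>v\<in>e. x v)"

text \<open>For two-element edges this is the sum of the signs of the neighbours of
  \<open>u\<close>, where unlabeled neighbours have sign 0. Writing the other endpoint as a product
  over \<open>e - {u}\<close> avoids naming it.\<close>

definition pull :: "'a set set \<Rightarrow> ('a \<Rightarrow> int) \<Rightarrow> 'a \<Rightarrow> int" where
  "pull E x u = (\<Sum>e\<in>{e\<in>E. u \<in> e}. \<Prod>v\<in>e - {u}. x v)"

lemma signed_cut_Un: "finite E \<Longrightarrow> finite F \<Longrightarrow> E \<inter> F = {} \<Longrightarrow>
    signed_cut (E \<union> F) x = signed_cut E x + signed_cut F x"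
  by (simp add: signed_cut_def sum.union_disjoint)

lemma signed_cut_insert:
  "finite E \<Longrightarrow> {u, v} \<notin> E \<Longrightarrow> u \<noteq> v \<Longrightarrow> signed_cut (insert {u, v} E) x = signed_cut E x - x u * x v"
  by (simp add: signed_cut_def)

text \<open>While \<open>u\<close> has sign 0, every edge at \<open>u\<close> contributes nothing;
  giving it the sign \<open>a\<close> switches on exactly the terms collected in the pull.\<close>

lemma signed_cut_update:
  assumes "finite E" "\<And>e. e \<in> E \<Longrightarrow> finite e" "x u = 0"
  shows "signed_cut E (x(u := a)) = signed_cut E x - a * pull E x u"
proof -
  have "(\<Prod>v\<in>e. (x(u := a)) v) =
      (\<Prod>v\<in>e. x v) + (if u \<in> e then a * (\<Prod>v\<in>e - {u}. x v) else 0)" if "e \<in> E" for e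
  proof (cases "u \<in> e")
    case True
    have "(\<Prod>v\<in>e - {u}. (x(u := a)) v) = (\<Prod>v\<in>e - {u}. x v)"
      by (rule prod.cong) auto
    then show ?thesis
      using True assms that by (simp add: prod.remove[of e u])
  qed (auto intro: prod.cong)
  then have "(\<Sum>e\<in>E. \<Prod>v\<in>e. (x(u := a)) v) =
      (\<Sum>e\<in>E. (\<Prod>v\<in>e. x v) + (if u \<in> e then a * (\<Prod>v\<in>e - {u}. x v) else 0))"
    by (rule sum.cong[OF refl])
  also have "\<dots> = (\<Sum>e\<in>E. \<Prod>v\<in>e. x v) + a * pull E x u"
    using assms(1) by (simp add: sum.distrib pull_def sum.inter_filter sum_distrib_left if_distrib[of "(*) a"] cong: if_cong)
  finally show ?thesis
    by (simp add: signed_cut_def)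
qed

text \<open>Each product runs over the single other endpoint, so it is monotone in that sign. Hence
  a vertex taken by Impish never lowers the pull on another vertex.\<close>

lemma pull_mono:
  assumes "\<And>e. e \<in> E \<Longrightarrow> card e = 2" "\<And>c. x c \<le> y c"
  shows "pull E x u \<le> pull E y u"
  unfolding pull_def
proof (rule sum_mono)
  fix e assume "e \<in> {e \<in> E. u \<in> e}"
  then have "card e = 2" "u \<in> e"
    using assms(1) by auto
  then obtain c where "e - {u} = {c}"
    by (metis One_nat_def card_1_singletonE card_Diff_singleton diff_Suc_1 numeral_2_eq_2)
  then show "(\<Prod>v\<in>e - {u}. x v) \<le> (\<Prod>v\<in>e - {u}. y v)"
    using assms(2) by simp
qed

section \<open>Labelings as signs\<close>

definition sgn_of :: "('a \<rightharpoonup> nat) \<Rightarrow> 'a \<Rightarrow> int" where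
  "sgn_of L v = (case L v of None \<Rightarrow> 0 | Some k \<Rightarrow> if even k then - 1 else 1)"

lemma sgn_of_upd: "sgn_of (L(v \<mapsto> k)) = (sgn_of L)(v := if even k then - 1 else 1)"
  by (auto simp: sgn_of_def)

lemma sgn_of_eq_0_iff: "sgn_of L v = 0 \<longleftrightarrow> v \<notin> dom L"
  by (auto simp: sgn_of_def split: option.splits)

lemma sgn_of_abs: "v \<in> dom L \<Longrightarrow> \<bar>sgn_of L v\<bar> = 1"
  by (auto simp: sgn_of_def)

lemma unlabeled_upd: "unlabeled G (L(v \<mapsto> k)) = unlabeled G L - {v}"
  by (auto simp: unlabeled_def)

lemma edgeE:
  assumes "graph G" "e \<in> edges G"
  obtains u v where "e = {u, v}" "u \<noteq> v" "u \<in> verts G" "v \<in> verts G"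
proof -
  interpret graph G by fact
  show thesis
    using assms(2) that unfolding edges_def
    by (auto dest: adj_not_same adj_in_verts)
qed

lemma graph_edges:
  assumes "graph G"
  shows "finite (edges G)" "\<And>e. e \<in> edges G \<Longrightarrow> card e = 2" "\<And>e. e \<in> edges G \<Longrightarrow> finite e"
proof -
  interpret graph G by fact
  have "edges G \<subseteq> Pow (verts G)"
    using assms by (auto elim: edgeE)
  then show "finite (edges G)"
    by (rule finite_subset) simp
qed (use assms in \<open>auto elim!: edgeE\<close>)

text \<open>An edge with both ends labeled has label 1 exactly when the signs of its ends differ,
  that is, when their product is -1. Both sides depend only on the parity of the labels, so the
  labels need not be known to be 0 or 1.\<close>

lemma discrepancy_eq_signed_cut:
  assumes "graph G" "unlabeled G L = {}"
  shows "discrepancy G (\<lambda>v. the (L v)) = signed_cut (edges G) (sgn_of L)"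
proof -
  let ?l = "edge_label (\<lambda>v. the (L v))"
  have prod: "- (\<Prod>v\<in>e. sgn_of L v) = of_bool (?l e = 1) - of_bool (?l e = 0)"
    if mem: "e \<in> edges G" for e
  proof -
    obtain u v where e: "e = {u, v}" "u \<noteq> v" "u \<in> verts G" "v \<in> verts G"
      using edgeE[OF assms(1) mem] .
    moreover from this have "u \<in> dom L" "v \<in> dom L"
      using assms(2) by (auto simp: unlabeled_def)
    then obtain j k where "L u = Some j" "L v = Some k"
      by blast
    ultimately show ?thesis
      by (auto simp: edge_label_def sgn_of_def mod2_eq_if)
  qed
  have "signed_cut (edges G) (sgn_of L) = (\<Sum>e\<in>edges G. of_bool (?l e = 1) - of_bool (?l e = 0))"
    unfolding signed_cut_def sum_negf[symmetric] by (rule sum.cong) (use prod in auto)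
  then show ?thesis
    using graph_edges(1)[OF assms(1)]
    by (simp add: discrepancy_def sum_subtractf Int_def)
qed

section \<open>Lower bounds for the game value, and the greedy strategy\<close>

lemma game_value_final: "unlabeled G L = {} \<Longrightarrow> game_value G P L = discrepancy G (\<lambda>v. the (L v))"
  by (simp add: game_value.simps)

lemma game_value_Admirable_ge:
  assumes "finite (verts G)" "unlabeled G L \<noteq> {}"
    "\<And>v. v \<in> unlabeled G L \<Longrightarrow> c \<le> game_value G Impish (L(v \<mapsto> 0))"
  shows "c \<le> game_value G Admirable L"
proof -
  have "finite (unlabeled G L)"
    using assms(1) by (simp add: unlabeled_def)
  then show ?thesis
    using assms by (subst game_value.simps) simp
qed

text \<open>One good move bounds a maximum from below, whereas the rule for Admirable has to treat
  all her moves. The strategies of Impish enter through the choice of \<open>u\<close>.\<close>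

lemma game_value_Impish_ge:
  assumes "finite (verts G)" "u \<in> unlabeled G L" "c \<le> game_value G Admirable (L(u \<mapsto> 1))"
  shows "c \<le> game_value G Impish L"
proof -
  have "finite (unlabeled G L)"
    using assms(1) by (simp add: unlabeled_def)
  then show ?thesis
    using assms by (subst game_value.simps) (auto simp: Max_ge_iff)
qed

text \<open>Taking \<open>u\<close> costs Impish its pull, and the reply \<open>v\<close> returns
  the pull of \<open>v\<close> at that moment. The latter is at least the earlier pull of
  \<open>v\<close>, hence at least the minimal pull, that of \<open>u\<close>. Evenness guarantees
  that Admirable always has a reply.\<close>

lemma greedy:
  assumes "graph G" "even (card (unlabeled G L))" "0 \<le> signed_cut (edges G) (sgn_of L)"
  shows "0 \<le> game_value G Impish L"
  using assms(2,3)
proof (induction "card (unlabeled G L)" arbitrary: L rule: less_induct)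
  case less
  interpret graph G by fact
  note E = graph_edges[OF assms(1)]
  have fin: "finite (unlabeled G L)"
    by (simp add: unlabeled_def)
  show ?case
  proof (cases "unlabeled G L = {}")
    case True
    then show ?thesis
      using less.prems assms(1) by (simp add: game_value_final discrepancy_eq_signed_cut)
  next
    case False
    let ?x = "sgn_of L" and ?w = "pull (edges G) (sgn_of L)"
    obtain u where u: "u \<in> unlabeled G L" and le: "\<And>v. v \<in> unlabeled G L \<Longrightarrow> ?w u \<le> ?w v"
      using fin False by (metis arg_min_if_finite(1) arg_min_least)
    have "0 \<le> game_value G Admirable (L(u \<mapsto> 1))"
    proof (rule game_value_Admirable_ge)
      \<comment> \<open>If \<open>u\<close> were the only unlabeled vertex, the number of unlabeled
        vertices would be odd.\<close>
      show "unlabeled G (L(u \<mapsto> 1)) \<noteq> {}"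
        using less.prems(1) u by (auto simp: unlabeled_upd subset_singleton_iff)
      fix v assume "v \<in> unlabeled G (L(u \<mapsto> 1))"
      then have v: "v \<in> unlabeled G L" "v \<noteq> u"
        by (auto simp: unlabeled_upd)
      define L' where "L' = L(u \<mapsto> 1, v \<mapsto> 0)"
      have 0: "?x u = 0" "?x v = 0"
        using u v by (auto simp: sgn_of_eq_0_iff unlabeled_def)
      have "?w v \<le> pull (edges G) (?x(u := 1)) v"
        using 0 E(2) by (intro pull_mono) auto
      then have "signed_cut (edges G) ?x \<le> signed_cut (edges G) (?x(u := 1, v := - 1))"
        using 0 E v le[OF v(1)] by (simp add: signed_cut_update)
      then have "0 \<le> signed_cut (edges G) (sgn_of L')"
        using less.prems(2) by (simp add: L'_def sgn_of_upd)
      moreover have "card (unlabeled G L) = card (unlabeled G L') + 2"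
        using u v fin card_Suc_Diff1[of "unlabeled G L" u] card_Suc_Diff1[of "unlabeled G L - {u}" v]
        by (simp add: L'_def unlabeled_upd)
      ultimately show "0 \<le> game_value G Impish (L(u \<mapsto> 1, v \<mapsto> 0))"
        using less.hyps[of L'] less.prems(1) by (simp add: L'_def)
    qed simp
    then show ?thesis
      using u by (intro game_value_Impish_ge[of G u]) simp_all
  qed
qed

section \<open>Pairing strategies\<close>

definition pairing :: "'a set \<Rightarrow> 'a set set \<Rightarrow> bool" where
  "pairing A P \<longleftrightarrow> partition_on A P \<and> (\<forall>p\<in>P. card p = 2)"

text \<open>A static guarantee that mentions no play: it covers every complete assignment of signs
  that splits the pairs, whatever signs the vertices outside the pairs carry. For a pair, sign sum 0
  means opposite signs.\<close>

definition favourable :: "'a set \<Rightarrow> 'a set set \<Rightarrow> 'a set set \<Rightarrow> bool" where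
  "favourable V E P \<longleftrightarrow>
     (\<forall>x. (\<forall>v\<in>V. \<bar>x v\<bar> = 1) \<longrightarrow> (\<forall>p\<in>P. sum x p = 0) \<longrightarrow> 0 \<le> signed_cut E x)"

lemma pairing_Un: "pairing A P \<Longrightarrow> pairing B Q \<Longrightarrow> A \<inter> B = {} \<Longrightarrow> pairing (A \<union> B) (P \<union> Q)"
  unfolding pairing_def partition_on_def
  by (auto intro!: disjoint_union)

lemma pairing_pair: "a \<noteq> b \<Longrightarrow> pairing {a, b} {{a, b}}"
  by (auto simp: pairing_def partition_on_def)

lemma pairing_partner:
  assumes "pairing A P" "v \<in> A"
  obtains u where "u \<in> A" "u \<noteq> v" "{u, v} \<in> P" "\<And>p. p \<in> P \<Longrightarrow> p \<noteq> {u, v} \<Longrightarrow> u \<notin> p \<and> v \<notin> p"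
proof -
  obtain p where p: "p \<in> P" "v \<in> p"
    using assms by (auto simp: pairing_def partition_on_def)
  then have "card p = 2"
    using assms(1) by (simp add: pairing_def)
  then obtain u where u: "p = {u, v}" "u \<noteq> v"
    using p(2) by (auto simp: card_2_iff)
  have "u \<notin> q \<and> v \<notin> q" if "q \<in> P" "q \<noteq> {u, v}" for q
  proof -
    have "p \<inter> q = {}"
      using assms(1) that p u by (intro disjointD) (auto simp: pairing_def partition_on_def)
    then show ?thesis
      using u by auto
  qed
  moreover have "u \<in> A"
    using assms(1) p u by (auto simp: pairing_def partition_on_def)
  ultimately show thesis
    using that u p by simp
qed

text \<open>An unlabeled vertex has sign \<open>0\<close>, so a pair with sign sum \<open>0\<close> is either untouched or split
  between the two players.\<close>

lemma pairing_strategy: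
  assumes "graph G" "pairing A P" "unlabeled G L \<subseteq> A" "A \<subseteq> verts G"
    "\<forall>p\<in>P. sum (sgn_of L) p = 0" "favourable (verts G) (edges G) P"
  shows "0 \<le> game_value G Admirable L"
  using assms(3,5)
proof (induction "card (unlabeled G L)" arbitrary: L rule: less_induct)
  case less
  interpret graph G by fact
  have fin: "finite (unlabeled G L)"
    by (simp add: unlabeled_def)
  show ?case
  proof (cases "unlabeled G L = {}")
    case True
    then have "0 \<le> signed_cut (edges G) (sgn_of L)"
      using assms(6)[unfolded favourable_def] less.prems(2)
      by (simp add: sgn_of_abs subset_iff unlabeled_def)
    then show ?thesis
      using True assms(1) by (simp add: game_value_final discrepancy_eq_signed_cut)
  next
    case False
    then show ?thesis
    proof (rule game_value_Admirable_ge[rotated])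
      fix v assume v: "v \<in> unlabeled G L"
      then obtain u where u: "u \<in> A" "u \<noteq> v" "{u, v} \<in> P"
        and other: "\<And>p. p \<in> P \<Longrightarrow> p \<noteq> {u, v} \<Longrightarrow> u \<notin> p \<and> v \<notin> p"
        using less.prems pairing_partner[OF assms(2)] by (metis subsetD)
      \<comment> \<open>The pair sums to 0 and \<open>v\<close> is untouched, so its partner
        \<open>u\<close> is untouched too and Impish can reply there.\<close>
      have "sgn_of L v = 0"
        using v by (simp add: sgn_of_eq_0_iff unlabeled_def)
      moreover have "sgn_of L u + sgn_of L v = 0"
        using less.prems(2) u by force
      ultimately have u': "u \<in> unlabeled G L"
        using u(1) assms(4) by (auto simp: unlabeled_def simp flip: sgn_of_eq_0_iff)
      define L' where "L' = L(v \<mapsto> 0, u \<mapsto> 1)"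
      have "sum (sgn_of L') p = 0" if "p \<in> P" for p
      proof (cases "p = {u, v}")
        case True
        then show ?thesis
          using u by (simp add: L'_def sgn_of_upd)
      next
        case False
        then have "sum (sgn_of L') p = sum (sgn_of L) p"
          using other[OF that] by (intro sum.cong) (auto simp: L'_def sgn_of_upd)
        then show ?thesis
          using less.prems(2) that by simp
      qed
      moreover have "card (unlabeled G L') < card (unlabeled G L)"
        using v u' fin by (auto simp: L'_def unlabeled_upd intro!: psubset_card_mono)
      ultimately have "0 \<le> game_value G Admirable L'"
        using less.hyps[of L'] less.prems(1) by (auto simp: L'_def unlabeled_upd)
      then show "0 \<le> game_value G Impish (L(v \<mapsto> 0))"
        using u u' by (intro game_value_Impish_ge[of G u]) (auto simp: L'_def unlabeled_upd)
    qed simp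
  qed
qed

section \<open>Pairings along a rooted tree\<close>

definition near_pairing :: "'a set \<Rightarrow> 'a set set \<Rightarrow> 'a \<Rightarrow> 'a set set \<Rightarrow> bool" where
  "near_pairing V E r P \<longleftrightarrow> finite V \<and> r \<in> V \<and> E \<subseteq> Pow V - {{}} \<and>
     pairing (V - {r}) P \<and> favourable V E P"

lemma near_pairing_finite: "near_pairing V E r P \<Longrightarrow> finite E"
  unfolding near_pairing_def by (meson finite_Diff finite_Pow_iff finite_subset)

text \<open>This is why \<open>near_pairing\<close> excludes the empty set as an edge: it could lie
  in both edge sets, and signed cuts would not add up.\<close>

lemma Pow_nonempty_disjoint:
  "E \<subseteq> Pow V - {{}} \<Longrightarrow> F \<subseteq> Pow W - {{}} \<Longrightarrow> V \<inter> W = {} \<Longrightarrow> E \<inter> F = {}"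
  by blast

text \<open>The parameter \<open>q\<close> covers two shapes, in both of which \<open>a\<close> and
  \<open>b\<close> have opposite signs. For \<open>q = r\<close> they are siblings and the two new
  edges cancel. For \<open>q = a\<close> they form the chain \<open>r\<close>, \<open>a\<close>,
  \<open>b\<close>: the edge between \<open>a\<close> and \<open>b\<close> gains 1, while the edge
  above it loses at most 1.\<close>

lemma near_pairing_join3:
  assumes 1: "near_pairing V\<^sub>1 E\<^sub>1 r P\<^sub>1" and 2: "near_pairing V\<^sub>2 E\<^sub>2 a P\<^sub>2"
    and 3: "near_pairing V\<^sub>3 E\<^sub>3 b P\<^sub>3"
    and disj: "V\<^sub>1 \<inter> V\<^sub>2 = {}" "V\<^sub>1 \<inter> V\<^sub>3 = {}" "V\<^sub>2 \<inter> V\<^sub>3 = {}" and q: "q = r \<or> q = a"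
  shows "near_pairing (V\<^sub>1 \<union> V\<^sub>2 \<union> V\<^sub>3) (insert {r, a} (insert {q, b} (E\<^sub>1 \<union> E\<^sub>2 \<union> E\<^sub>3))) r
    (P\<^sub>1 \<union> P\<^sub>2 \<union> P\<^sub>3 \<union> {{a, b}})"
    (is "near_pairing ?V ?E r ?P")
proof -
  note sub = 1[unfolded near_pairing_def] 2[unfolded near_pairing_def] 3[unfolded near_pairing_def]
  note fin = near_pairing_finite[OF 1] near_pairing_finite[OF 2] near_pairing_finite[OF 3]
  have in_V: "\<And>e. e \<in> E\<^sub>1 \<Longrightarrow> e \<subseteq> V\<^sub>1" "\<And>e. e \<in> E\<^sub>2 \<Longrightarrow> e \<subseteq> V\<^sub>2" "\<And>e. e \<in> E\<^sub>3 \<Longrightarrow> e \<subseteq> V\<^sub>3"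
    using sub by blast+
  have notin: "r \<notin> V\<^sub>2" "r \<notin> V\<^sub>3" "a \<notin> V\<^sub>1" "a \<notin> V\<^sub>3" "b \<notin> V\<^sub>1" "b \<notin> V\<^sub>2"
    using sub disj by blast+
  then have neq: "r \<noteq> a" "r \<noteq> b" "a \<noteq> b"
    using sub by blast+
  have "pairing ((V\<^sub>1 - {r}) \<union> (V\<^sub>2 - {a}) \<union> (V\<^sub>3 - {b}) \<union> {a, b}) ?P"
    using sub disj neq by (intro pairing_Un pairing_pair) auto
  moreover have "(V\<^sub>1 - {r}) \<union> (V\<^sub>2 - {a}) \<union> (V\<^sub>3 - {b}) \<union> {a, b} = ?V - {r}"
    using sub disj neq by auto
  moreover have "favourable ?V ?E ?P"
    unfolding favourable_def
  proof (intro allI impI)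
    fix x :: "'a \<Rightarrow> int"
    assume x: "\<forall>v\<in>?V. \<bar>x v\<bar> = 1" and P: "\<forall>p\<in>?P. sum x p = 0"
    have "0 \<le> signed_cut E\<^sub>1 x" "0 \<le> signed_cut E\<^sub>2 x" "0 \<le> signed_cut E\<^sub>3 x"
      using sub x P unfolding favourable_def by auto
    moreover have "E\<^sub>1 \<inter> E\<^sub>2 = {}" "E\<^sub>1 \<inter> E\<^sub>3 = {}" "E\<^sub>2 \<inter> E\<^sub>3 = {}"
      using sub disj Pow_nonempty_disjoint by metis+
    then have "signed_cut (E\<^sub>1 \<union> E\<^sub>2 \<union> E\<^sub>3) x = signed_cut E\<^sub>1 x + signed_cut E\<^sub>2 x + signed_cut E\<^sub>3 x"
      using fin by (simp add: signed_cut_Un Int_Un_distrib2)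
    moreover have "{q, b} \<notin> E\<^sub>1 \<union> E\<^sub>2 \<union> E\<^sub>3" "{r, a} \<notin> insert {q, b} (E\<^sub>1 \<union> E\<^sub>2 \<union> E\<^sub>3)" "q \<noteq> b"
      using in_V notin q neq by (fastforce simp: doubleton_eq_iff)+
    then have "signed_cut ?E x = signed_cut (E\<^sub>1 \<union> E\<^sub>2 \<union> E\<^sub>3) x - x q * x b - x r * x a"
      using fin neq by (simp add: signed_cut_insert)
    moreover have "x r * x a + x q * x b \<le> 0"
    proof -
      have "\<bar>x r\<bar> = 1" "\<bar>x a\<bar> = 1" "x b = - x a"
        using x P sub neq by auto
      then show ?thesis
        using q by (auto simp: abs_if split: if_splits)
    qed
    ultimately show "0 \<le> signed_cut ?E x"
      by linarith
  qed
  moreover have "E\<^sub>1 \<union> E\<^sub>2 \<union> E\<^sub>3 \<subseteq> Pow ?V - {{}}" "{r, a} \<subseteq> ?V" "{q, b} \<subseteq> ?V"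
    using sub q by blast+
  then have "?E \<subseteq> Pow ?V - {{}}"
    by simp
  ultimately show ?thesis
    using sub unfolding near_pairing_def by simp
qed

text \<open>Trees grow by hanging a whole subtree below the root, so that the parities of the two
  parts decide how to pair.\<close>

inductive rooted_tree :: "'a set \<Rightarrow> 'a set set \<Rightarrow> 'a \<Rightarrow> bool" where
  single: "rooted_tree {r} {} r"
| join: "rooted_tree V E r \<Longrightarrow> rooted_tree W F s \<Longrightarrow> V \<inter> W = {} \<Longrightarrow>
    rooted_tree (V \<union> W) (insert {r, s} (E \<union> F)) r"

lemma rooted_tree_finite: "rooted_tree V E r \<Longrightarrow> finite V"
  by (induction rule: rooted_tree.induct) auto

text \<open>Connects growth by single leaves, as it arises in a graph, with the rule
  \<open>join\<close>: the leaf is passed down to the part that contains \<open>p\<close>.\<close>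

lemma rooted_tree_add_leaf:
  assumes "rooted_tree V E r" "p \<in> V" "v \<notin> V"
  shows "rooted_tree (insert v V) (insert {p, v} E) r"
  using assms
proof (induction rule: rooted_tree.induct)
  case (single r)
  then show ?case
    using rooted_tree.join[OF rooted_tree.single rooted_tree.single, of r v]
    by (simp add: insert_commute)
next
  case (join V E r W F s)
  show ?case
  proof (cases "p \<in> V")
    case True
    then show ?thesis
      using rooted_tree.join[of "insert v V" "insert {p, v} E" r W F s] join
      by (simp add: insert_commute)
  next
    case False
    then show ?thesis
      using rooted_tree.join[of V E r "insert v W" "insert {p, v} F" s] join
      by (simp add: insert_commute)
  qed
qed

text \<open>An even tree splits at an edge into two odd ones; pairing the ends of that edge with each
  other yields a gain of one, which pays for the edge attaching the tree to a parent.\<close>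

lemma rooted_tree_pairing:
  assumes "rooted_tree V E r"
  shows "(odd (card V) \<longrightarrow> (\<exists>P. near_pairing V E r P)) \<and>
    (even (card V) \<longrightarrow> (\<exists>V\<^sub>1 V\<^sub>2 E\<^sub>1 E\<^sub>2 c P\<^sub>1 P\<^sub>2. near_pairing V\<^sub>1 E\<^sub>1 r P\<^sub>1 \<and> near_pairing V\<^sub>2 E\<^sub>2 c P\<^sub>2 \<and>
       V\<^sub>1 \<inter> V\<^sub>2 = {} \<and> V = V\<^sub>1 \<union> V\<^sub>2 \<and> E = insert {r, c} (E\<^sub>1 \<union> E\<^sub>2)))"
    (is "_ \<and> (_ \<longrightarrow> ?split V E r)")
  using assms
proof (induction rule: rooted_tree.induct)
  case (single r)
  have "near_pairing {r} {} r {}"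
    by (auto simp: near_pairing_def pairing_def favourable_def partition_on_def signed_cut_def)
  then show ?case
    by auto
next
  case (join V E r W F s)
  have card: "card (V \<union> W) = card V + card W"
    using join.hyps by (intro card_Un_disjoint rooted_tree_finite)
  consider "odd (card V)" "odd (card W)" | "odd (card V)" "even (card W)"
    | "even (card V)" "odd (card W)" | "even (card V)" "even (card W)"
    by blast
  then show ?case
  proof cases
    \<comment> \<open>The new edge itself separates the two odd parts, so the split is taken with
      \<open>c = s\<close>.\<close>
    case 1
    then show ?thesis
      using join card by (simp; blast)
  next
    case 2
    then obtain P where P: "near_pairing V E r P"
      using join.IH(1) by blast
    obtain W\<^sub>1 W\<^sub>2 F\<^sub>1 F\<^sub>2 c Q\<^sub>1 Q\<^sub>2 where W: "near_pairing W\<^sub>1 F\<^sub>1 s Q\<^sub>1" "near_pairing W\<^sub>2 F\<^sub>2 c Q\<^sub>2"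
      "W\<^sub>1 \<inter> W\<^sub>2 = {}" "W = W\<^sub>1 \<union> W\<^sub>2" "F = insert {s, c} (F\<^sub>1 \<union> F\<^sub>2)"
      using join.IH(2) 2 by blast
    have "V \<inter> W\<^sub>1 = {}" "V \<inter> W\<^sub>2 = {}"
      using join.hyps W by auto
    \<comment> \<open>Chain shape \<open>r\<close>, \<open>s\<close>, \<open>c\<close>: the pair
      \<open>{s, c}\<close> pays for the new edge.\<close>
    then have "near_pairing (V \<union> W) (insert {r, s} (E \<union> F)) r (P \<union> Q\<^sub>1 \<union> Q\<^sub>2 \<union> {{s, c}})"
      using near_pairing_join3[OF P W(1,2) _ _ W(3), of s] W(4,5) by (simp add: Un_ac insert_commute)
    then show ?thesis
      using 2 card by auto
  next
    case 3
    then obtain Q where Q: "near_pairing W F s Q"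
      using join.IH(2) by blast
    obtain V\<^sub>1 V\<^sub>2 E\<^sub>1 E\<^sub>2 c P\<^sub>1 P\<^sub>2 where V: "near_pairing V\<^sub>1 E\<^sub>1 r P\<^sub>1" "near_pairing V\<^sub>2 E\<^sub>2 c P\<^sub>2"
      "V\<^sub>1 \<inter> V\<^sub>2 = {}" "V = V\<^sub>1 \<union> V\<^sub>2" "E = insert {r, c} (E\<^sub>1 \<union> E\<^sub>2)"
      using join.IH(1) 3 by blast
    have "V\<^sub>1 \<inter> W = {}" "V\<^sub>2 \<inter> W = {}"
      using join.hyps V by auto
    \<comment> \<open>Sibling shape: both \<open>c\<close> and \<open>s\<close> hang below
      \<open>r\<close> and are paired with each other.\<close>
    then have "near_pairing (V \<union> W) (insert {r, s} (E \<union> F)) r (P\<^sub>1 \<union> P\<^sub>2 \<union> Q \<union> {{c, s}})"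
      using near_pairing_join3[OF V(1,2) Q V(3), of r] V(4,5) by (simp add: Un_ac insert_commute)
    then show ?thesis
      using 3 card by auto
  next
    case 4
    obtain V\<^sub>1 V\<^sub>2 E\<^sub>1 E\<^sub>2 c P\<^sub>1 P\<^sub>2 where V: "near_pairing V\<^sub>1 E\<^sub>1 r P\<^sub>1" "near_pairing V\<^sub>2 E\<^sub>2 c P\<^sub>2"
      "V\<^sub>1 \<inter> V\<^sub>2 = {}" "V = V\<^sub>1 \<union> V\<^sub>2" "E = insert {r, c} (E\<^sub>1 \<union> E\<^sub>2)"
      using join.IH(1) 4 by blast
    obtain W\<^sub>1 W\<^sub>2 F\<^sub>1 F\<^sub>2 d Q\<^sub>1 Q\<^sub>2 where W: "near_pairing W\<^sub>1 F\<^sub>1 s Q\<^sub>1" "near_pairing W\<^sub>2 F\<^sub>2 d Q\<^sub>2"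
      "W\<^sub>1 \<inter> W\<^sub>2 = {}" "W = W\<^sub>1 \<union> W\<^sub>2" "F = insert {s, d} (F\<^sub>1 \<union> F\<^sub>2)"
      using join.IH(2) 4 by blast
    have "V\<^sub>1 \<inter> W\<^sub>1 = {}" "V\<^sub>1 \<inter> W\<^sub>2 = {}"
      using join.hyps V W by auto
    \<comment> \<open>The even tree \<open>W\<close> is absorbed into the odd half at the root,
      again by the chain shape; the old edge between \<open>r\<close> and \<open>c\<close> still
      splits the whole tree.\<close>
    then have "near_pairing (V\<^sub>1 \<union> W) (insert {r, s} (E\<^sub>1 \<union> F)) r (P\<^sub>1 \<union> Q\<^sub>1 \<union> Q\<^sub>2 \<union> {{s, d}})"
      using near_pairing_join3[OF V(1) W(1,2) _ _ W(3), of s] W(4,5)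
      by (simp add: Un_ac insert_commute)
    moreover have "(V\<^sub>1 \<union> W) \<inter> V\<^sub>2 = {}" "V \<union> W = (V\<^sub>1 \<union> W) \<union> V\<^sub>2"
      "insert {r, s} (E \<union> F) = insert {r, c} (insert {r, s} (E\<^sub>1 \<union> F) \<union> E\<^sub>2)"
      using join.hyps V by auto
    ultimately have "?split (V \<union> W) (insert {r, s} (E \<union> F)) r"
      using V(2) by blast
    then show ?thesis
      using 4 card by auto
  qed
qed

text \<open>Pairing the two leftover roots with each other completes the pairing, and the edge
  joining them contributes 1.\<close>

lemma rooted_tree_pairing_even:
  assumes "rooted_tree V E r" "even (card V)"
  obtains P where "pairing V P" "favourable V E P"
proof -
  obtain V\<^sub>1 V\<^sub>2 E\<^sub>1 E\<^sub>2 c P\<^sub>1 P\<^sub>2 where 1: "near_pairing V\<^sub>1 E\<^sub>1 r P\<^sub>1" and 2: "near_pairing V\<^sub>2 E\<^sub>2 c P\<^sub>2"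
    and V: "V\<^sub>1 \<inter> V\<^sub>2 = {}" "V = V\<^sub>1 \<union> V\<^sub>2" "E = insert {r, c} (E\<^sub>1 \<union> E\<^sub>2)"
    using rooted_tree_pairing[OF assms(1)] assms(2) by blast
  note sub = 1[unfolded near_pairing_def] 2[unfolded near_pairing_def]
  let ?P = "P\<^sub>1 \<union> P\<^sub>2 \<union> {{r, c}}"
  have "r \<noteq> c"
    using sub V by blast
  have "pairing ((V\<^sub>1 - {r}) \<union> (V\<^sub>2 - {c}) \<union> {r, c}) ?P"
    using sub V \<open>r \<noteq> c\<close> by (intro pairing_Un pairing_pair) auto
  moreover have "(V\<^sub>1 - {r}) \<union> (V\<^sub>2 - {c}) \<union> {r, c} = V"
    using sub V by auto
  moreover have "favourable V E ?P"
    unfolding favourable_def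
  proof (intro allI impI)
    fix x :: "'a \<Rightarrow> int"
    assume x: "\<forall>v\<in>V. \<bar>x v\<bar> = 1" and P: "\<forall>p\<in>?P. sum x p = 0"
    have nonneg: "0 \<le> signed_cut E\<^sub>1 x" "0 \<le> signed_cut E\<^sub>2 x"
      using sub x P V unfolding favourable_def by auto
    have "E\<^sub>1 \<inter> E\<^sub>2 = {}"
      using sub V Pow_nonempty_disjoint by metis
    moreover have "{r, c} \<notin> E\<^sub>1 \<union> E\<^sub>2"
      using sub V(1) by blast
    ultimately have "signed_cut E x = signed_cut E\<^sub>1 x + signed_cut E\<^sub>2 x - x r * x c"
      using near_pairing_finite[OF 1] near_pairing_finite[OF 2] \<open>r \<noteq> c\<close>
      by (simp add: V(3) signed_cut_Un signed_cut_insert)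
    moreover have "x c = - x r"
      using P \<open>r \<noteq> c\<close> by auto
    ultimately show "0 \<le> signed_cut E x"
      using nonneg by simp
  qed
  ultimately show thesis
    using that by simp
qed

section \<open>Undirected trees as rooted trees\<close>

definition path_connected_in :: "('a, 'b) pre_digraph \<Rightarrow> 'a set \<Rightarrow> bool" where
  "path_connected_in G S \<longleftrightarrow>
     (\<forall>a\<in>S. \<forall>b\<in>S. \<exists>p. pre_digraph.apath G a p b \<and> set (pre_digraph.awalk_verts G a p) \<subseteq> S)"

context graph
begin

lemma dominates_arc:
  assumes "u \<rightarrow>\<^bsub>G\<^esub> v"
  obtains e where "e \<in> arcs G" "tail G e = u" "head G e = v"
  using assms by (auto simp: arcs_ends_def arc_to_ends_def)

lemma apath_snoc:
  assumes "apath a p b" "b \<rightarrow>\<^bsub>G\<^esub> w" "w \<notin> set (awalk_verts a p)"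
  obtains e where "apath a (p @ [e]) w" "awalk_verts a (p @ [e]) = awalk_verts a p @ [w]"
proof -
  obtain e where e: "e \<in> arcs G" "tail G e = b" "head G e = w"
    using dominates_arc[OF assms(2)] .
  have "awalk a p b"
    using assms(1) by (simp add: apath_def)
  moreover have "awalk b [e] w"
    using e arc_implies_awalk by blast
  ultimately have "awalk a (p @ [e]) w"
    "awalk_verts a (p @ [e]) = awalk_verts a p @ [w]"
    using e by (auto intro: awalk_appendI simp: awalk_verts_append awalk_ends)
  then show thesis
    using that assms by (auto simp: apath_def)
qed

text \<open>Paths to \<open>v\<close> extend paths to \<open>p\<close>; paths from \<open>v\<close>
  start with the reverse arc, which symmetry provides. They repeat no vertex because
  \<open>v\<close> lies outside \<open>S\<close>.\<close>

lemma path_connected_in_insert: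
  assumes S: "path_connected_in G S" and v: "p \<in> S" "p \<rightarrow>\<^bsub>G\<^esub> v" "v \<notin> S"
  shows "path_connected_in G (insert v S)"
proof -
  have path: "\<exists>q. apath a q b \<and> set (awalk_verts a q) \<subseteq> S" if "a \<in> S" "b \<in> S" for a b
    using S that by (auto simp: path_connected_in_def)
  obtain e where e: "e \<in> arcs G" "tail G e = v" "head G e = p"
    using v(2) dominates_arc graph_symmetric by metis
  have to: "\<exists>q. apath a q v \<and> set (awalk_verts a q) \<subseteq> insert v S" if a: "a \<in> S" for a
  proof -
    obtain q where "apath a q p" "set (awalk_verts a q) \<subseteq> S"
      using path[OF a v(1)] by blast
    then show ?thesis
      using apath_snoc[OF _ v(2), of a q] v(3) by (metis (no_types) Un_insert_right append_Nil2
          insert_subset list.set(2) list.set(1) set_append subsetD subset_insertI2 insertI1 sup_bot_right)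
  qed
  have out_of: "\<exists>q. apath v q b \<and> set (awalk_verts v q) \<subseteq> insert v S" if b: "b \<in> S" for b
  proof -
    obtain q where "apath p q b" "set (awalk_verts p q) \<subseteq> S"
      using path[OF v(1) b] by blast
    then have "apath v (e # q) b" "set (awalk_verts v (e # q)) \<subseteq> insert v S"
      using e v(3) by (auto simp: apath_Cons_iff)
    then show ?thesis
      by blast
  qed
  have "apath v [] v"
    using adj_in_verts(2)[OF v(2)] by (simp add: apath_Nil_iff)
  then show ?thesis
    using path to out_of unfolding path_connected_in_def
    by (auto, (force | (meson subset_insertI2))+)
qed

text \<open>Two distinct neighbours in \<open>S\<close> would be joined by a path inside
  \<open>S\<close>, which closes up through \<open>w\<close>. The path has at least one arc, so the
  cycle has length at least 3 and is not just the two opposite arcs of one edge.\<close>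

lemma unique_neighbour:
  assumes S: "path_connected_in G S" and w: "w \<notin> S"
    and a: "a \<in> S" "a \<rightarrow>\<^bsub>G\<^esub> w" and b: "b \<in> S" "b \<rightarrow>\<^bsub>G\<^esub> w"
    and acyclic: "\<not> (\<exists>p. cycle p \<and> 3 \<le> length p)"
  shows "a = b"
proof (rule ccontr)
  assume "a \<noteq> b"
  obtain p where p: "apath a p b" "set (awalk_verts a p) \<subseteq> S"
    using S a(1) b(1) unfolding path_connected_in_def by blast
  have "p \<noteq> []"
    using p \<open>a \<noteq> b\<close> by (auto simp: apath_Nil_iff)
  obtain e where e: "e \<in> arcs G" "tail G e = w" "head G e = a"
    using a(2) dominates_arc graph_symmetric by metis
  obtain f where f: "apath a (p @ [f]) w"
    using apath_snoc[OF p(1) b(2)] p(2) w by blast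
  have "awalk w (e # p @ [f]) w"
    using f e by (auto simp: apath_def awalk_Cons_iff)
  \<comment> \<open>The vertex list starts and ends with \<open>w\<close>; dropping the first copy
    leaves the vertices of the path from \<open>a\<close> to \<open>w\<close>.\<close>
  moreover have "distinct (tl (awalk_verts w (e # p @ [f])))"
    using f e by (simp add: apath_def)
  ultimately have "cycle (e # p @ [f])"
    unfolding cycle_def by blast
  moreover have "3 \<le> length (e # p @ [f])"
    using \<open>p \<noteq> []\<close> by (cases p) auto
  ultimately show False
    using acyclic by blast
qed

lemma crossing_arc:
  assumes "u \<rightarrow>\<^sup>*\<^bsub>G\<^esub> v" "u \<in> S" "v \<notin> S"
  obtains a b where "a \<in> S" "b \<notin> S" "a \<rightarrow>\<^bsub>G\<^esub> b"
proof -
  have "v \<in> S \<or> (\<exists>a b. a \<in> S \<and> b \<notin> S \<and> a \<rightarrow>\<^bsub>G\<^esub> b)"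
    using assms(1)
  proof (induction rule: reachable_induct)
    case base
    then show ?case
      using assms(2) by simp
  next
    case (step x y)
    then show ?case
      by blast
  qed
  then show thesis
    using that assms(3) by blast
qed

end

text \<open>A connected vertex set is grown one vertex at a time from \<open>r\<close>, keeping its
  induced edges a rooted tree. Connectivity of \<open>G\<close> supplies an arc leaving the set, and
  acyclicity makes the new vertex a leaf.\<close>

lemma undirected_tree_rooted_tree:
  assumes "undirected_tree G"
  obtains r where "rooted_tree (verts G) (edges G) r"
proof -
  interpret graph G
    using assms by (simp add: undirected_tree_def)
  have acyclic: "\<not> (\<exists>p. cycle p \<and> 3 \<le> length p)"
    using assms by (simp add: undirected_tree_def)
  have conn: "strongly_connected G"
    using assms symmetric_connected_imp_strongly_connected[OF sym_arcs]
    by (simp add: undirected_tree_def)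
  then obtain r where r: "r \<in> verts G"
    unfolding strongly_connected_def by blast
  let ?E = "\<lambda>S. {e \<in> edges G. e \<subseteq> S}"
  have grow: "\<exists>S. S \<subseteq> verts G \<and> card S = Suc k \<and> rooted_tree S (?E S) r \<and> path_connected_in G S"
    if "k < card (verts G)" for k
    using that
  proof (induction k)
    case 0
    have "?E {r} = {}"
      using edgeE[OF graph_axioms] by (force simp: subset_singleton_iff)
    then have "rooted_tree {r} (?E {r}) r"
      using rooted_tree.single[of r] by (simp only:)
    moreover have "path_connected_in G {r}"
      using r unfolding path_connected_in_def
      by (auto simp: apath_Nil_iff intro!: exI[of _ "[]"])
    ultimately show ?case
      using r by (intro exI[of _ "{r}"]) simp
  next
    case (Suc k)
    then obtain S where S: "S \<subseteq> verts G" "card S = Suc k" "rooted_tree S (?E S) r"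
      "path_connected_in G S"
      by auto
    have "S \<noteq> {}" "S \<noteq> verts G"
      using S(2) Suc.prems by auto
    then obtain u v where "u \<in> S" "v \<in> verts G" "v \<notin> S"
      using S(1) by blast
    moreover from this have "u \<rightarrow>\<^sup>*\<^bsub>G\<^esub> v"
      using conn S(1) by blast
    ultimately obtain a w where aw: "a \<in> S" "w \<notin> S" "a \<rightarrow>\<^bsub>G\<^esub> w"
      using crossing_arc by metis
    \<comment> \<open>By \<open>unique_neighbour\<close>, \<open>a\<close> is the only neighbour of
      \<open>w\<close> in \<open>S\<close>, so exactly one induced edge is added.\<close>
    have "?E (insert w S) = insert {a, w} (?E S)"
    proof (intro set_eqI iffI)
      fix e assume e: "e \<in> ?E (insert w S)"
      show "e \<in> insert {a, w} (?E S)"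
      proof (cases "w \<in> e")
        case True
        obtain x y where xy: "e = {x, y}" "x \<rightarrow>\<^bsub>G\<^esub> y" "y \<rightarrow>\<^bsub>G\<^esub> x"
          using e graph_symmetric unfolding edges_def by blast
        then have "x \<noteq> y"
          using adj_not_same by blast
        with xy True obtain b where b: "e = {b, w}" "b \<rightarrow>\<^bsub>G\<^esub> w" "b \<noteq> w"
          by auto
        then have "b \<in> S"
          using e by auto
        then have "b = a"
          using unique_neighbour[OF S(4) aw(2) _ b(2) aw(1,3) acyclic] by blast
        then show ?thesis
          using b by simp
      qed (use e in auto)
    qed (use aw in \<open>auto simp: edges_def\<close>)
    then have "rooted_tree (insert w S) (?E (insert w S)) r"
      using rooted_tree_add_leaf[OF S(3) aw(1,2)] by simp
    moreover have "path_connected_in G (insert w S)"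
      using path_connected_in_insert[OF S(4) aw(1,3,2)] .
    moreover have "card (insert w S) = Suc (Suc k)"
      using S aw(2) by (simp add: rooted_tree_finite)
    ultimately show ?case
      using S(1) adj_in_verts(2)[OF aw(3)] by (metis insert_subset)
  qed
  have "0 < card (verts G)"
    using r by (auto simp: card_gt_0_iff)
  then obtain S where S: "S \<subseteq> verts G" "card S = card (verts G)" "rooted_tree S (?E S) r"
    using grow[of "card (verts G) - 1"] by auto
  then have "S = verts G"
    by (simp add: card_subset_eq)
  moreover have "?E (verts G) = edges G"
    using edgeE[OF graph_axioms] by blast
  ultimately show thesis
    using that S(3) by simp
qed

theorem theorem3p2:
  fixes T :: "('a, 'b) pre_digraph"
  assumes "undirected_tree T"
  shows "balance_game_A T \<ge> 0 \<and> balance_game_I T \<ge> 0"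
proof -
  have G: "graph T"
    using assms by (simp add: undirected_tree_def)
  interpret graph T by fact
  obtain r where tree: "rooted_tree (verts T) (edges T) r"
    using undirected_tree_rooted_tree[OF assms] .
  have start: "unlabeled T Map.empty = verts T" "sgn_of (Map.empty :: 'a \<rightharpoonup> nat) = (\<lambda>_. 0)"
    by (auto simp: unlabeled_def sgn_of_def)
  \<comment> \<open>Edges must be nonempty here, since an empty product would be 1.\<close>
  have cut0: "signed_cut (edges T) (\<lambda>_. 0) = 0"
    using graph_edges(2)[OF G] by (simp add: signed_cut_def)
  \<comment> \<open>The parity of the order decides who moves last: the second player if it is even,
    the first if it is odd.\<close>
  show ?thesis
  proof (cases "even (card (verts T))")
    case True
    obtain P where "pairing (verts T) P" "favourable (verts T) (edges T) P"
      using rooted_tree_pairing_even[OF tree True] .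
    then have "0 \<le> balance_game_A T"
      unfolding balance_game_A_def
      by (intro pairing_strategy[OF G]) (auto simp: start)
    moreover have "0 \<le> balance_game_I T"
      unfolding balance_game_I_def using True
      by (intro greedy[OF G]) (auto simp: start cut0)
    ultimately show ?thesis ..
  next
    case False
    then obtain P where P: "near_pairing (verts T) (edges T) r P"
      using rooted_tree_pairing[OF tree] by blast
    then have r: "r \<in> verts T" and pair: "pairing (verts T - {r}) P"
      by (auto simp: near_pairing_def)
    then have "\<forall>p\<in>P. r \<notin> p"
      by (auto simp: pairing_def partition_on_def)
    then have sum0: "\<forall>p\<in>P. sum (sgn_of (Map.empty(r \<mapsto> 1))) p = 0"
      by (auto simp: sgn_of_upd start(2) intro!: sum.neutral)
    \<comment> \<open>Impish opens at the unpaired root; the vertices left are exactly the paired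
      ones, with Admirable to move.\<close>
    have "0 \<le> game_value T Admirable (Map.empty(r \<mapsto> 1))"
      using P sum0 by (intro pairing_strategy[OF G pair])
        (auto simp: near_pairing_def unlabeled_upd start)
    then have "0 \<le> balance_game_I T"
      unfolding balance_game_I_def using r
      by (intro game_value_Impish_ge[of T r]) (auto simp: start)
    moreover have "0 \<le> balance_game_A T"
      unfolding balance_game_A_def
    proof (rule game_value_Admirable_ge)
      show "unlabeled T Map.empty \<noteq> {}"
        using r by (auto simp: start)
      fix v assume "v \<in> unlabeled T Map.empty"
      then have "even (card (unlabeled T (Map.empty(v \<mapsto> 0))))"
        using False by (simp add: unlabeled_upd start)
      \<comment> \<open>The opening move of Admirable meets no labeled neighbour, so the signed cut
        stays 0 and the greedy strategy applies to the even remainder.\<close>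
      moreover have "pull (edges T) (\<lambda>_. 0) v = 0"
        unfolding pull_def
      proof (rule sum.neutral, rule ballI)
        fix e assume e: "e \<in> {e \<in> edges T. v \<in> e}"
        then have "card (e - {v}) = 1"
          using graph_edges(2)[OF G, of e] by simp
        then show "(\<Prod>v\<in>e - {v}. 0) = (0 :: int)"
          by simp
      qed
      then have "0 \<le> signed_cut (edges T) (sgn_of (Map.empty(v \<mapsto> 0)))"
        using graph_edges[OF G] by (simp add: sgn_of_upd start signed_cut_update cut0)
      ultimately show "0 \<le> game_value T Impish (Map.empty(v \<mapsto> 0))"
        by (rule greedy[OF G])
    qed simp
    ultimately show ?thesis
      by simp
  qed
qed

end
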